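(* Let $k$ be a commutative unital ring, $A$ a commutative $k$-algebra, and $E$ a projective $A$-module with a projective basis $e_1,\dots,e_n\in E$, $x_1,\dots,x_n\in E^*=\operatorname{Hom}_A(E,A)$. For $l\ge0$ let $P^l=(A\otimes_kA)/I^{l+1}$ be the $l$-th module of principal parts, let $\partial^l:A\to P^l$, $\partial^l(a)=\overline{1\otimes a}$, and define \[\nabla^l:E\to P^l\otimes_AE,\qquad \nabla^l(e)=\sum_{i=1}^n\partial^l(x_i(e))\otimes e_i .\] Let $p_l:P^l\to P^{l-1}$ be the canonical projection. Then for all $l\ge1$: 1. $\nabla^l\in\operatorname{Diff}^l_k(E,P^l\otimes_AE)$; 2. $(p_l\otimes1)\circ\nabla^l=\nabla^{l-1}$.
   Context: Projective basis: finite families $e_1,\dots,e_n\in E$ and $x_1,\dots,x_n\in E^*$ with $\sum_jx_j(e)e_j=e$ for all $e\in E$. $I\subseteq A\otimes_kA$ is the kernel of the multiplication map $A\otimes_kA\to A$. $P^l$ is regarded as an $A$-module via the left tensor factor, $a\cdot\overline{b\otimes c}=\overline{ab\otimes c}$, and $P^l\otimes_AE$ is formed with respect to, and is an $A$-module through, this structure. For $A$-modules $E,F$ put $\operatorname{Diff}^{-1}_k(E,F)=0$ and, inductively for $l\ge0$, \[\operatorname{Diff}^l_k(E,F)=\{\partial\in\operatorname{Hom}_k(E,F):[\partial,a]\in\operatorname{Diff}^{l-1}_k(E,F)\text{ for all }a\in A\},\] where $[\partial,a](e)=\partial(ae)-a\partial(e)$. *)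

theory Defs
  imports
    "HOL-Algebra.Module"
    "HOL-Algebra.QuotRing"
    "HOL-Algebra.Ideal_Product"
    "HOL-Algebra.Free_Abelian_Groups"
begin

section \<open>Linear maps\<close>

text \<open>Maps are total HOL functions; only their values on the carrier of the domain matter.\<close>

definition module_Hom ::
  "('r, 'p) ring_scheme \<Rightarrow> ('r, 'm, 'x) module_scheme \<Rightarrow> ('r, 'n, 'y) module_scheme \<Rightarrow> ('m \<Rightarrow> 'n) set"
  where "module_Hom R M N =
    {f \<in> carrier M \<rightarrow> carrier N.
       (\<forall>u\<in>carrier M. \<forall>v\<in>carrier M. f (u \<oplus>\<^bsub>M\<^esub> v) = f u \<oplus>\<^bsub>N\<^esub> f v) \<and>
       (\<forall>r\<in>carrier R. \<forall>u\<in>carrier M. f (r \<odot>\<^bsub>M\<^esub> u) = r \<odot>\<^bsub>N\<^esub> f u)}"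

definition regular_module :: "('a, 'p) ring_scheme \<Rightarrow> ('a, 'a) module"
  where "regular_module A =
    \<lparr>carrier = carrier A, monoid.mult = monoid.mult A, one = one A,
     ring.zero = ring.zero A, add = add A, smult = monoid.mult A\<rparr>"

definition restrict_scalars :: "('k, 'a) module \<Rightarrow> ('a, 'm) module \<Rightarrow> ('k, 'm) module"
  where "restrict_scalars A M =
    \<lparr>carrier = carrier M, monoid.mult = monoid.mult M, one = one M, ring.zero = ring.zero M, add = add M,
     smult = (\<lambda>c u. (c \<odot>\<^bsub>A\<^esub> \<one>\<^bsub>A\<^esub>) \<odot>\<^bsub>M\<^esub> u)\<rparr>"

definition projective_basis ::
  "('k, 'a) module \<Rightarrow> ('a, 'e) module \<Rightarrow> nat \<Rightarrow> (nat \<Rightarrow> 'e) \<Rightarrow> (nat \<Rightarrow> 'e \<Rightarrow> 'a) \<Rightarrow> bool"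
  where "projective_basis A E n e x \<longleftrightarrow>
    (\<forall>j\<in>{1..n}. e j \<in> carrier E) \<and>
    (\<forall>j\<in>{1..n}. x j \<in> module_Hom A E (regular_module A)) \<and>
    (\<forall>u\<in>carrier E. finsum E (\<lambda>j. x j u \<odot>\<^bsub>E\<^esub> e j) {1..n} = u)"


section \<open>Tensor products\<close>

text \<open>
  The tensor product of two \<open>R\<close>-modules is the free abelian group on pairs, modulo the subgroup
  generated by the bilinearity relations; its elements are cosets of that subgroup.
\<close>

definition tensor_free :: "('r, 'm) module \<Rightarrow> ('r, 'n) module \<Rightarrow> ('m \<times> 'n \<Rightarrow>\<^sub>0 int) monoid"
  where "tensor_free M N = free_Abelian_group (carrier M \<times> carrier N)"

definition tensor_relators ::
  "('r, 'p) ring_scheme \<Rightarrow> ('r, 'm) module \<Rightarrow> ('r, 'n) module \<Rightarrow> ('m \<times> 'n \<Rightarrow>\<^sub>0 int) set"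
  where "tensor_relators R M N =
    {frag_of (u \<oplus>\<^bsub>M\<^esub> u', v) - frag_of (u, v) - frag_of (u', v) | u u' v.
       u \<in> carrier M \<and> u' \<in> carrier M \<and> v \<in> carrier N} \<union>
    {frag_of (u, v \<oplus>\<^bsub>N\<^esub> v') - frag_of (u, v) - frag_of (u, v') | u v v'.
       u \<in> carrier M \<and> v \<in> carrier N \<and> v' \<in> carrier N} \<union>
    {frag_of (r \<odot>\<^bsub>M\<^esub> u, v) - frag_of (u, r \<odot>\<^bsub>N\<^esub> v) | r u v.
       r \<in> carrier R \<and> u \<in> carrier M \<and> v \<in> carrier N}"

definition tensor_kernel ::
  "('r, 'p) ring_scheme \<Rightarrow> ('r, 'm) module \<Rightarrow> ('r, 'n) module \<Rightarrow> ('m \<times> 'n \<Rightarrow>\<^sub>0 int) set"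
  where "tensor_kernel R M N = generate (tensor_free M N) (tensor_relators R M N)"

definition tensor_group ::
  "('r, 'p) ring_scheme \<Rightarrow> ('r, 'm) module \<Rightarrow> ('r, 'n) module \<Rightarrow> ('m \<times> 'n \<Rightarrow>\<^sub>0 int) set monoid"
  where "tensor_group R M N = tensor_free M N Mod tensor_kernel R M N"

definition pure_tensor ::
  "('r, 'p) ring_scheme \<Rightarrow> ('r, 'm) module \<Rightarrow> ('r, 'n) module \<Rightarrow> 'm \<Rightarrow> 'n
    \<Rightarrow> ('m \<times> 'n \<Rightarrow>\<^sub>0 int) set"
  where "pure_tensor R M N u v = tensor_kernel R M N #>\<^bsub>tensor_free M N\<^esub> frag_of (u, v)"

text \<open>
  The homomorphism on the free abelian group of pairs that extends \<open>f\<close>, with values in a commutative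
  group \<open>G\<close> written multiplicatively. Ring and module structures are targets through their additive
  groups.
\<close>

definition free_lift ::
  "('g, 'q) monoid_scheme \<Rightarrow> ('m \<Rightarrow> 'n \<Rightarrow> 'g) \<Rightarrow> ('m \<times> 'n \<Rightarrow>\<^sub>0 int) \<Rightarrow> 'g"
  where "free_lift G f c =
    (\<Otimes>\<^bsub>G\<^esub>p\<in>Poly_Mapping.keys c. f (fst p) (snd p) [^]\<^bsub>G\<^esub> Poly_Mapping.lookup c p)"

text \<open>
  The homomorphism on the tensor product induced by a balanced biadditive map \<open>f\<close>: all representatives
  of the coset \<open>X\<close> have the same image under the homomorphism above.
\<close>

definition tensor_lift ::
  "('g, 'q) monoid_scheme \<Rightarrow> ('m \<Rightarrow> 'n \<Rightarrow> 'g) \<Rightarrow> ('m \<times> 'n \<Rightarrow>\<^sub>0 int) set \<Rightarrow> 'g"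
  where "tensor_lift G f X = the_elem (free_lift G f ` X)"

text \<open>
  A module is a record that extends a ring; the fields \<open>mult\<close> and \<open>one\<close> play no role in it.
\<close>

definition tensor_module ::
  "('r, 'p) ring_scheme \<Rightarrow> ('r, 'm) module \<Rightarrow> ('r, 'n) module
    \<Rightarrow> ('r, ('m \<times> 'n \<Rightarrow>\<^sub>0 int) set) module"
  where "tensor_module R M N =
    \<lparr>carrier = carrier (tensor_group R M N),
     monoid.mult = undefined,
     one = undefined,
     ring.zero = \<one>\<^bsub>tensor_group R M N\<^esub>,
     add = (\<lambda>X Y. X \<otimes>\<^bsub>tensor_group R M N\<^esub> Y),
     smult = (\<lambda>r. tensor_lift (tensor_group R M N) (\<lambda>u v. pure_tensor R M N (r \<odot>\<^bsub>M\<^esub> u) v))\<rparr>"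

definition tensor_algebra ::
  "('r, 'p) ring_scheme \<Rightarrow> ('r, 'm) module \<Rightarrow> ('r, 'n) module
    \<Rightarrow> ('r, ('m \<times> 'n \<Rightarrow>\<^sub>0 int) set) module"
  where "tensor_algebra R M N = (tensor_module R M N)
    \<lparr>monoid.mult := (\<lambda>X Y. tensor_lift (tensor_group R M N)
               (\<lambda>u v. tensor_lift (tensor_group R M N)
                        (\<lambda>u' v'. pure_tensor R M N (u \<otimes>\<^bsub>M\<^esub> u') (v \<otimes>\<^bsub>N\<^esub> v')) Y) X),
     one := pure_tensor R M N \<one>\<^bsub>M\<^esub> \<one>\<^bsub>N\<^esub>\<rparr>"


section \<open>Principal parts\<close>

definition multiplication_map :: "('k, 'a) module \<Rightarrow> ('a \<times> 'a \<Rightarrow>\<^sub>0 int) set \<Rightarrow> 'a"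
  where "multiplication_map A = tensor_lift (add_monoid A) (\<lambda>a b. a \<otimes>\<^bsub>A\<^esub> b)"

definition diagonal_ideal ::
  "('k, 'p) ring_scheme \<Rightarrow> ('k, 'a) module \<Rightarrow> ('a \<times> 'a \<Rightarrow>\<^sub>0 int) set set"
  where "diagonal_ideal k A = a_kernel (tensor_algebra k A A) A (multiplication_map A)"

text \<open>\<open>I\<^sup>l\<^sup>+\<^sup>1\<close>, as a power in the monoid of ideals under the ideal product.\<close>

definition parts_ideal ::
  "('k, 'p) ring_scheme \<Rightarrow> ('k, 'a) module \<Rightarrow> nat \<Rightarrow> ('a \<times> 'a \<Rightarrow>\<^sub>0 int) set set"
  where "parts_ideal k A l =
    diagonal_ideal k A [^]\<^bsub>ideals_set (tensor_algebra k A A)\<^esub> (l + 1)"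

definition parts_class ::
  "('k, 'p) ring_scheme \<Rightarrow> ('k, 'a) module \<Rightarrow> nat
    \<Rightarrow> ('a \<times> 'a \<Rightarrow>\<^sub>0 int) set \<Rightarrow> ('a \<times> 'a \<Rightarrow>\<^sub>0 int) set set"
  where "parts_class k A l t = parts_ideal k A l +>\<^bsub>tensor_algebra k A A\<^esub> t"

text \<open>
  The quotient ring, as an \<open>A\<close>-module through the left factor. All representatives \<open>t\<close> of \<open>X\<close> give
  the same class, so the union below is that class.
\<close>

definition principal_parts ::
  "('k, 'p) ring_scheme \<Rightarrow> ('k, 'a) module \<Rightarrow> nat
    \<Rightarrow> ('a, ('a \<times> 'a \<Rightarrow>\<^sub>0 int) set set) module"
  where "principal_parts k A l =
    (let T = tensor_algebra k A A; P = T Quot parts_ideal k A l in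
     \<lparr>carrier = carrier P, monoid.mult = monoid.mult P, one = one P, ring.zero = ring.zero P, add = add P,
      smult = (\<lambda>a X. \<Union>t\<in>X. parts_class k A l
        (tensor_lift (add_monoid T) (\<lambda>b c. pure_tensor k A A (a \<otimes>\<^bsub>A\<^esub> b) c) t))\<rparr>)"

definition parts_universal ::
  "('k, 'p) ring_scheme \<Rightarrow> ('k, 'a) module \<Rightarrow> nat \<Rightarrow> 'a \<Rightarrow> ('a \<times> 'a \<Rightarrow>\<^sub>0 int) set set"
  where "parts_universal k A l a = parts_class k A l (pure_tensor k A A \<one>\<^bsub>A\<^esub> a)"

text \<open>The canonical projection from order \<open>l\<close> to order \<open>l - 1\<close>; only used for \<open>l \<ge> 1\<close>.\<close>

definition parts_projection ::
  "('k, 'p) ring_scheme \<Rightarrow> ('k, 'a) module \<Rightarrow> nat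
    \<Rightarrow> ('a \<times> 'a \<Rightarrow>\<^sub>0 int) set set \<Rightarrow> ('a \<times> 'a \<Rightarrow>\<^sub>0 int) set set"
  where "parts_projection k A l X = (\<Union>t\<in>X. parts_class k A (l - 1) t)"

definition parts_tensor ::
  "('k, 'p) ring_scheme \<Rightarrow> ('k, 'a) module \<Rightarrow> ('a, 'e) module \<Rightarrow> nat
    \<Rightarrow> ('a, (('a \<times> 'a \<Rightarrow>\<^sub>0 int) set set \<times> 'e \<Rightarrow>\<^sub>0 int) set) module"
  where "parts_tensor k A E l = tensor_module A (principal_parts k A l) E"

definition parts_projection_tensor ::
  "('k, 'p) ring_scheme \<Rightarrow> ('k, 'a) module \<Rightarrow> ('a, 'e) module \<Rightarrow> nat
    \<Rightarrow> (('a \<times> 'a \<Rightarrow>\<^sub>0 int) set set \<times> 'e \<Rightarrow>\<^sub>0 int) set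
    \<Rightarrow> (('a \<times> 'a \<Rightarrow>\<^sub>0 int) set set \<times> 'e \<Rightarrow>\<^sub>0 int) set"
  where "parts_projection_tensor k A E l =
    tensor_lift (add_monoid (parts_tensor k A E (l - 1)))
      (\<lambda>s u. pure_tensor A (principal_parts k A (l - 1)) E (parts_projection k A l s) u)"

definition parts_connection ::
  "('k, 'p) ring_scheme \<Rightarrow> ('k, 'a) module \<Rightarrow> ('a, 'e) module
    \<Rightarrow> nat \<Rightarrow> (nat \<Rightarrow> 'e) \<Rightarrow> (nat \<Rightarrow> 'e \<Rightarrow> 'a) \<Rightarrow> nat
    \<Rightarrow> 'e \<Rightarrow> (('a \<times> 'a \<Rightarrow>\<^sub>0 int) set set \<times> 'e \<Rightarrow>\<^sub>0 int) set"
  where "parts_connection k A E n e x l u =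
    finsum (parts_tensor k A E l)
      (\<lambda>i. pure_tensor A (principal_parts k A l) E (parts_universal k A l (x i u)) (e i)) {1..n}"


section \<open>Differential operators\<close>

definition commutator ::
  "('a, 'e) module \<Rightarrow> ('a, 'f) module \<Rightarrow> ('e \<Rightarrow> 'f) \<Rightarrow> 'a \<Rightarrow> 'e \<Rightarrow> 'f"
  where "commutator E F d a u = d (a \<odot>\<^bsub>E\<^esub> u) \<ominus>\<^bsub>F\<^esub> (a \<odot>\<^bsub>F\<^esub> d u)"

text \<open>The index is shifted by one so that it starts at order \<open>-1\<close>.\<close>

primrec Diff_shifted ::
  "('k, 'p) ring_scheme \<Rightarrow> ('k, 'a) module \<Rightarrow> ('a, 'e) module \<Rightarrow> ('a, 'f) module \<Rightarrow> nat
    \<Rightarrow> ('e \<Rightarrow> 'f) set"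
  where
    "Diff_shifted k A E F 0 =
      {d \<in> module_Hom k (restrict_scalars A E) (restrict_scalars A F).
         \<forall>u\<in>carrier E. d u = \<zero>\<^bsub>F\<^esub>}"
  | "Diff_shifted k A E F (Suc m) =
      {d \<in> module_Hom k (restrict_scalars A E) (restrict_scalars A F).
         \<forall>a\<in>carrier A. commutator E F d a \<in> Diff_shifted k A E F m}"

definition Diff ::
  "('k, 'p) ring_scheme \<Rightarrow> ('k, 'a) module \<Rightarrow> ('a, 'e) module \<Rightarrow> ('a, 'f) module \<Rightarrow> nat
    \<Rightarrow> ('e \<Rightarrow> 'f) set"
  where "Diff k A E F l = Diff_shifted k A E F (Suc l)"

end

theory Submission
  imports Defs
begin

text \<open>
  For \<open>s \<in> A \<otimes> A\<close> twist the connection to \<open>D\<^sub>s(u) = \<Sum>\<^sub>i [s (1 \<otimes> x\<^sub>i(u))] \<otimes> e\<^sub>i\<close>, so that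
  \<open>D\<^sub>1 = \<nabla>\<^sup>l\<close>. The \<open>A\<close>-linearity of the \<open>x\<^sub>i\<close> gives \<open>[D\<^sub>s, a] = D\<^sub>t\<close> with \<open>t = s (1 \<otimes> a - a \<otimes> 1)\<close>, and
  \<open>1 \<otimes> a - a \<otimes> 1\<close> lies in \<open>I\<close>. After \<open>l + 1\<close> commutators the twist lies in \<open>I\<^sup>l\<^sup>+\<^sup>1\<close>, where \<open>D\<^sub>s\<close>
  vanishes. Compatibility with the projections holds summand by summand.
\<close>

section \<open>Lifting to free abelian groups and tensor products\<close>

text \<open>\<open>free_lift\<close> multiplies over the support of \<open>c\<close>, which changes
  with \<open>c\<close>. Points outside the support carry exponent \<open>0\<close> and contribute
  \<open>1\<close>, so several elements can be treated over a common finite index set.\<close>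

lemma (in comm_group) free_lift_superset:
  assumes "\<And>u v. (u, v) \<in> S \<Longrightarrow> f u v \<in> carrier G" "finite S" "Poly_Mapping.keys c \<subseteq> S"
  shows "free_lift G f c = (\<Otimes>p\<in>S. f (fst p) (snd p) [^] Poly_Mapping.lookup c p)"
  unfolding free_lift_def using assms
  by (intro finprod_mono_neutral_cong_left) (auto simp: in_keys_iff)

lemma (in comm_group) free_lift_hom:
  assumes "\<And>u v. (u, v) \<in> S \<Longrightarrow> f u v \<in> carrier G"
  shows "free_lift G f \<in> hom (free_Abelian_group S) G"
proof (rule homI)
  fix c assume "c \<in> carrier (free_Abelian_group S)"
  then show "free_lift G f c \<in> carrier G"
    using assms by (auto simp: free_lift_def intro!: finprod_closed)
next
  fix c d assume c: "c \<in> carrier (free_Abelian_group S)" and d: "d \<in> carrier (free_Abelian_group S)"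
  \<comment> \<open>Cancellation can make the support of \<open>c + d\<close> smaller than this
    union, so all three products are taken over the union.\<close>
  let ?K = "Poly_Mapping.keys c \<union> Poly_Mapping.keys d"
  have f: "f u v \<in> carrier G" if "(u, v) \<in> ?K" for u v
    using assms c d that by auto
  have "free_lift G f (c + d) = (\<Otimes>p\<in>?K. f (fst p) (snd p) [^] Poly_Mapping.lookup (c + d) p)"
    using f keys_add[of c d] by (intro free_lift_superset) auto
  also have "\<dots> = (\<Otimes>p\<in>?K. f (fst p) (snd p) [^] Poly_Mapping.lookup c p
                 \<otimes> f (fst p) (snd p) [^] Poly_Mapping.lookup d p)"
    using f by (intro finprod_cong) (auto simp: lookup_add int_pow_mult)
  also have "\<dots> = (\<Otimes>p\<in>?K. f (fst p) (snd p) [^] Poly_Mapping.lookup c p)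
               \<otimes> (\<Otimes>p\<in>?K. f (fst p) (snd p) [^] Poly_Mapping.lookup d p)"
    using f by (intro finprod_multf) auto
  also have "\<dots> = free_lift G f c \<otimes> free_lift G f d"
    using f by (subst (1 2) free_lift_superset[where S = ?K]) auto
  finally show "free_lift G f (c \<otimes>\<^bsub>free_Abelian_group S\<^esub> d) = free_lift G f c \<otimes> free_lift G f d"
    by simp
qed

lemma (in comm_group) free_lift_frag_of:
  assumes "f u v \<in> carrier G"
  shows "free_lift G f (frag_of (u, v)) = f u v"
proof -
  have "free_lift G f (frag_of (u, v))
      = (\<Otimes>p\<in>{(u, v)}. f (fst p) (snd p) [^] Poly_Mapping.lookup (frag_of (u, v)) p)"
    using assms by (intro free_lift_superset) auto
  then show ?thesis
    using assms by (simp add: finprod_singleton)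
qed

section \<open>The tensor product of two modules as an abelian group\<close>

locale tensor_product = M: module R M + N: module R N
  for R :: "('r, 'p) ring_scheme" (structure) and M :: "('r, 'm) module" and N :: "('r, 'n) module"
begin

abbreviation "T \<equiv> tensor_module R M N"
abbreviation "pure \<equiv> pure_tensor R M N"
abbreviation "F \<equiv> tensor_free M N"
abbreviation "K \<equiv> tensor_kernel R M N"

text \<open>The target is written multiplicatively, as for \<open>free_lift\<close>, so that one
  notion serves both \<open>tensor_group\<close> and the \<open>add_monoid\<close> of a ring or
  module.\<close>

definition balanced_map :: "('b, 'q) monoid_scheme \<Rightarrow> ('m \<Rightarrow> 'n \<Rightarrow> 'b) \<Rightarrow> bool"
  where "balanced_map G f \<longleftrightarrow>
    (\<forall>u\<in>carrier M. \<forall>v\<in>carrier N. f u v \<in> carrier G) \<and>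
    (\<forall>u\<in>carrier M. \<forall>u'\<in>carrier M. \<forall>v\<in>carrier N. f (u \<oplus>\<^bsub>M\<^esub> u') v = f u v \<otimes>\<^bsub>G\<^esub> f u' v) \<and>
    (\<forall>u\<in>carrier M. \<forall>v\<in>carrier N. \<forall>v'\<in>carrier N. f u (v \<oplus>\<^bsub>N\<^esub> v') = f u v \<otimes>\<^bsub>G\<^esub> f u v') \<and>
    (\<forall>r\<in>carrier R. \<forall>u\<in>carrier M. \<forall>v\<in>carrier N. f (r \<odot>\<^bsub>M\<^esub> u) v = f u (r \<odot>\<^bsub>N\<^esub> v))"

lemma comm_group_free: "comm_group F"
  by (simp add: tensor_free_def abelian_free_Abelian_group)

sublocale F: comm_group F
  by (rule comm_group_free)

lemma relators_closed: "tensor_relators R M N \<subseteq> carrier F"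
  by (auto simp: tensor_relators_def tensor_free_def keys_frag_of
      dest!: subsetD[OF keys_diff])

lemma subgroup_kernel: "subgroup K F"
  unfolding tensor_kernel_def using F.generate_is_subgroup[OF relators_closed] .

lemma normal_kernel: "K \<lhd> F"
  using F.subgroup_imp_normal[OF subgroup_kernel] .

lemma comm_group_tensor_group: "comm_group (tensor_group R M N)"
  unfolding tensor_group_def using F.abelian_FactGroup[OF subgroup_kernel] .

lemma carrier_tensor_group: "carrier (tensor_group R M N) = carrier T"
  by (simp add: tensor_module_def)

lemma mult_tensor_group: "X \<otimes>\<^bsub>tensor_group R M N\<^esub> Y = X \<oplus>\<^bsub>T\<^esub> Y"
  by (simp add: tensor_module_def)

lemma one_tensor_group: "\<one>\<^bsub>tensor_group R M N\<^esub> = \<zero>\<^bsub>T\<^esub>"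
  by (simp add: tensor_module_def)

lemma carrier_T: "carrier T = (\<lambda>c. K #>\<^bsub>F\<^esub> c) ` carrier F"
  by (simp add: tensor_module_def tensor_group_def carrier_FactGroup)

lemma coset_add:
  assumes "c \<in> carrier F" "d \<in> carrier F"
  shows "(K #>\<^bsub>F\<^esub> c) \<oplus>\<^bsub>T\<^esub> (K #>\<^bsub>F\<^esub> d) = K #>\<^bsub>F\<^esub> (c + d)"
  using normal.rcos_sum[OF normal_kernel assms]
  by (simp add: tensor_module_def tensor_group_def) (simp add: tensor_free_def)

lemma coset_zero: "K #>\<^bsub>F\<^esub> 0 = \<zero>\<^bsub>T\<^esub>"
  using F.coset_mult_one[OF subgroup.subset[OF subgroup_kernel]]
  by (simp add: tensor_module_def tensor_group_def) (simp add: tensor_free_def)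

text \<open>These rules loop together with the definition of \<open>tensor_module\<close>.\<close>

lemmas tensor_group_simps [simp] = carrier_tensor_group mult_tensor_group one_tensor_group

text \<open>Addition in \<open>T\<close> is multiplication in the quotient group, so each axiom is a
  group axiom of \<open>tensor_group R M N\<close> in additive notation.\<close>

lemma abelian_group_tensor: "abelian_group T"
proof -
  interpret G: comm_group "tensor_group R M N" by (rule comm_group_tensor_group)
  show ?thesis
    by (rule abelian_groupI) (fact G.m_closed[unfolded tensor_group_simps]
      G.one_closed[unfolded tensor_group_simps] G.m_assoc[unfolded tensor_group_simps]
      G.m_comm[unfolded tensor_group_simps] G.l_one[unfolded tensor_group_simps]
      G.l_inv_ex[unfolded tensor_group_simps])+
qed

sublocale T: abelian_group T
  by (rule abelian_group_tensor)

lemma frag_closed [simp]: "u \<in> carrier M \<Longrightarrow> v \<in> carrier N \<Longrightarrow> frag_of (u, v) \<in> carrier F"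
  by (simp add: tensor_free_def)

lemma pure_closed [simp, intro]: "u \<in> carrier M \<Longrightarrow> v \<in> carrier N \<Longrightarrow> pure u v \<in> carrier T"
  by (simp add: carrier_T pure_tensor_def)

lemma free_plus: "c \<otimes>\<^bsub>F\<^esub> d = c + d"
  by (simp add: tensor_free_def)

lemma free_inv: "c \<in> carrier F \<Longrightarrow> inv\<^bsub>F\<^esub> c = - c"
  by (simp add: tensor_free_def)

lemma diff_closed: "c \<in> carrier F \<Longrightarrow> d \<in> carrier F \<Longrightarrow> c - d \<in> carrier F"
  using F.m_closed[OF _ F.inv_closed, of c d] by (simp add: free_plus free_inv)

lemma coset_eqI:
  assumes "c \<in> carrier F" "d \<in> carrier F" "c - d \<in> K"
  shows "K #>\<^bsub>F\<^esub> c = K #>\<^bsub>F\<^esub> d"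
proof -
  have "c = (c - d) \<otimes>\<^bsub>F\<^esub> d" by (simp add: free_plus)
  then have "c \<in> K #>\<^bsub>F\<^esub> d"
    using assms(3) unfolding r_coset_def by blast
  then show ?thesis
    using F.repr_independence subgroup_kernel assms by metis
qed

lemma relators_in_kernel: "c \<in> tensor_relators R M N \<Longrightarrow> c \<in> K"
  unfolding tensor_kernel_def by (rule generate.incl)

lemma pure_add_l:
  assumes "u \<in> carrier M" "u' \<in> carrier M" "v \<in> carrier N"
  shows "pure (u \<oplus>\<^bsub>M\<^esub> u') v = pure u v \<oplus>\<^bsub>T\<^esub> pure u' v"
proof -
  have "frag_of (u \<oplus>\<^bsub>M\<^esub> u', v) - (frag_of (u, v) + frag_of (u', v)) \<in> K"
    using assms by (intro relators_in_kernel) (auto simp: tensor_relators_def diff_diff_eq)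
  then show ?thesis
    using assms F.m_closed[of "frag_of (u, v)" "frag_of (u', v)"]
    unfolding pure_tensor_def by (simp add: free_plus coset_add coset_eqI)
qed

lemma pure_add_r:
  assumes "u \<in> carrier M" "v \<in> carrier N" "v' \<in> carrier N"
  shows "pure u (v \<oplus>\<^bsub>N\<^esub> v') = pure u v \<oplus>\<^bsub>T\<^esub> pure u v'"
proof -
  have "frag_of (u, v \<oplus>\<^bsub>N\<^esub> v') - (frag_of (u, v) + frag_of (u, v')) \<in> K"
    using assms by (intro relators_in_kernel) (auto simp: tensor_relators_def diff_diff_eq)
  then show ?thesis
    using assms F.m_closed[of "frag_of (u, v)" "frag_of (u, v')"]
    unfolding pure_tensor_def by (simp add: free_plus coset_add coset_eqI)
qed

lemma pure_balanced:
  assumes "r \<in> carrier R" "u \<in> carrier M" "v \<in> carrier N"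
  shows "pure (r \<odot>\<^bsub>M\<^esub> u) v = pure u (r \<odot>\<^bsub>N\<^esub> v)"
proof -
  have "frag_of (r \<odot>\<^bsub>M\<^esub> u, v) - frag_of (u, r \<odot>\<^bsub>N\<^esub> v) \<in> K"
    using assms by (intro relators_in_kernel) (auto simp: tensor_relators_def)
  then show ?thesis
    using assms unfolding pure_tensor_def by (intro coset_eqI) auto
qed

lemma pure_zero_l [simp]:
  assumes "v \<in> carrier N"
  shows "pure \<zero>\<^bsub>M\<^esub> v = \<zero>\<^bsub>T\<^esub>"
proof -
  have "pure \<zero>\<^bsub>M\<^esub> v \<oplus>\<^bsub>T\<^esub> pure \<zero>\<^bsub>M\<^esub> v = pure \<zero>\<^bsub>M\<^esub> v"
    using assms by (simp flip: pure_add_l)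
  then show ?thesis
    using assms by (metis T.add.r_cancel_one M.zero_closed pure_closed)
qed

lemma pure_minus_l:
  assumes "u \<in> carrier M" "v \<in> carrier N"
  shows "\<ominus>\<^bsub>T\<^esub> pure u v = pure (\<ominus>\<^bsub>M\<^esub> u) v"
proof (rule T.minus_equality)
  show "pure (\<ominus>\<^bsub>M\<^esub> u) v \<oplus>\<^bsub>T\<^esub> pure u v = \<zero>\<^bsub>T\<^esub>"
    using assms by (simp add: M.l_neg flip: pure_add_l)
qed (use assms in auto)

text \<open>Negatives of pure tensors are again pure, as
  \<open>-(u \<otimes> v) = (-u) \<otimes> v\<close>. Hence sums of pure tensors exhaust
  \<open>T\<close>, and no case for zero or negation arises.\<close>

lemma tensor_induct [consumes 1, case_names pure add]:
  assumes "X \<in> carrier T"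
    and pure: "\<And>u v. u \<in> carrier M \<Longrightarrow> v \<in> carrier N \<Longrightarrow> P (pure u v)"
    and add: "\<And>X Y. X \<in> carrier T \<Longrightarrow> Y \<in> carrier T \<Longrightarrow> P X \<Longrightarrow> P Y \<Longrightarrow> P (X \<oplus>\<^bsub>T\<^esub> Y)"
  shows "P X"
proof -
  \<comment> \<open>Induction on the free abelian group has a case for differences. Carrying the
    claim for \<open>- c\<close> along turns \<open>c - d\<close> into the sum of \<open>c\<close>
    and \<open>- d\<close>.\<close>
  have *: "P (K #>\<^bsub>F\<^esub> c) \<and> P (K #>\<^bsub>F\<^esub> (- c))" if "Poly_Mapping.keys c \<subseteq> carrier M \<times> carrier N" for c
    using that
  proof (induction c rule: free_Abelian_group_induct [consumes 1, case_names zero diff frag])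
    case zero
    have "K #>\<^bsub>F\<^esub> 0 = pure \<zero>\<^bsub>M\<^esub> \<zero>\<^bsub>N\<^esub>"
      by (simp add: coset_zero)
    then show ?case using pure[of "\<zero>\<^bsub>M\<^esub>" "\<zero>\<^bsub>N\<^esub>"] by simp
  next
    case (diff c d)
    have c: "c \<in> carrier F" "- c \<in> carrier F" and d: "d \<in> carrier F" "- d \<in> carrier F"
      using diff by (auto simp: tensor_free_def)
    have "K #>\<^bsub>F\<^esub> (c - d) = (K #>\<^bsub>F\<^esub> c) \<oplus>\<^bsub>T\<^esub> (K #>\<^bsub>F\<^esub> (- d))"
         "K #>\<^bsub>F\<^esub> (- (c - d)) = (K #>\<^bsub>F\<^esub> (- c)) \<oplus>\<^bsub>T\<^esub> (K #>\<^bsub>F\<^esub> d)"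
      using c d by (simp_all add: coset_add)
    then show ?case
      using diff c d by (auto intro!: add simp: carrier_T)
  next
    case (frag p)
    obtain u v where p: "p = (u, v)" "u \<in> carrier M" "v \<in> carrier N"
      using frag by auto
    have f: "frag_of p \<in> carrier F" "- frag_of p \<in> carrier F"
      using frag by (auto simp: tensor_free_def)
    have "(K #>\<^bsub>F\<^esub> (- frag_of p)) \<oplus>\<^bsub>T\<^esub> (K #>\<^bsub>F\<^esub> frag_of p) = K #>\<^bsub>F\<^esub> 0"
      using f by (simp add: coset_add)
    also have "\<dots> = \<zero>\<^bsub>T\<^esub>"
      by (rule coset_zero)
    finally have "\<ominus>\<^bsub>T\<^esub> (K #>\<^bsub>F\<^esub> frag_of p) = K #>\<^bsub>F\<^esub> (- frag_of p)"
      using f by (intro T.minus_equality) (auto simp: carrier_T)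
    then have "K #>\<^bsub>F\<^esub> (- frag_of p) = pure (\<ominus>\<^bsub>M\<^esub> u) v"
      using p pure_minus_l[of u v] by (simp add: pure_tensor_def)
    then show ?case
      using pure[of u v] pure[of "\<ominus>\<^bsub>M\<^esub> u" v] p by (simp add: pure_tensor_def)
  qed
  show ?thesis
    using assms(1) * by (auto simp: carrier_T) (auto simp: tensor_free_def)
qed

section \<open>Homomorphisms induced by balanced maps\<close>

context
  fixes G :: "('b, 'q) monoid_scheme" and f
  assumes G: "comm_group G" and bal: "balanced_map G f"
begin

interpretation G: comm_group G by (rule G)

lemma free_lift_group_hom: "group_hom F G (free_lift G f)"
proof -
  have "free_lift G f \<in> hom F G"
    unfolding tensor_free_def using bal
    by (intro G.free_lift_hom) (auto simp: balanced_map_def)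
  then show ?thesis
    by (intro group_hom.intro group_hom_axioms.intro F.group_axioms G.group_axioms)
qed

interpretation h: group_hom F G "free_lift G f"
  by (rule free_lift_group_hom)

lemma free_lift_diff:
  assumes "c \<in> carrier F" "d \<in> carrier F"
  shows "free_lift G f (c - d) = free_lift G f c \<otimes>\<^bsub>G\<^esub> inv\<^bsub>G\<^esub> free_lift G f d"
  using h.hom_mult[OF assms(1) F.inv_closed[OF assms(2)]] h.hom_inv[OF assms(2)] assms
  by (simp add: free_plus free_inv)

lemma free_lift_frag:
  "u \<in> carrier M \<Longrightarrow> v \<in> carrier N \<Longrightarrow> free_lift G f (frag_of (u, v)) = f u v"
  using bal by (intro G.free_lift_frag_of) (auto simp: balanced_map_def)

text \<open>The relators map to the unit because \<open>f\<close> is balanced; kernels are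
  subgroups, so the subgroup \<open>K\<close> generated by the relators maps to the unit as
  well.\<close>

lemma free_lift_kernel:
  assumes "c \<in> K"
  shows "free_lift G f c = \<one>\<^bsub>G\<^esub>"
proof -
  \<comment> \<open>The image of a biadditivity relator: \<open>b\<close> and \<open>b'\<close>
    stand for the values of \<open>f\<close> at the two summands.\<close>
  have 1: "b \<otimes>\<^bsub>G\<^esub> b' \<otimes>\<^bsub>G\<^esub> inv\<^bsub>G\<^esub> b \<otimes>\<^bsub>G\<^esub> inv\<^bsub>G\<^esub> b' = \<one>\<^bsub>G\<^esub>" if "b \<in> carrier G" "b' \<in> carrier G" for b b'
    using that by (simp add: G.m_comm[of b b'] G.inv_solve_right')
  have "tensor_relators R M N \<subseteq> kernel F G (free_lift G f)"
    using bal relators_closed unfolding kernel_def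
    by (auto simp: tensor_relators_def free_lift_diff free_lift_frag balanced_map_def diff_closed 1)
  then have "K \<subseteq> kernel F G (free_lift G f)"
    unfolding tensor_kernel_def by (intro F.generate_subgroup_incl h.subgroup_kernel)
  then show ?thesis
    using assms by (auto simp: kernel_def)
qed

text \<open>\<open>tensor_lift\<close> reads off the only element of the image of a coset. Two
  representatives differ by an element of \<open>K\<close>, which maps to the unit, so the image is
  indeed a singleton.\<close>

lemma tensor_lift_coset:
  assumes "c \<in> carrier F"
  shows "tensor_lift G f (K #>\<^bsub>F\<^esub> c) = free_lift G f c"
proof -
  have "free_lift G f (k \<otimes>\<^bsub>F\<^esub> c) = free_lift G f c" if "k \<in> K" for k
    using h.hom_mult[OF subgroup.mem_carrier[OF subgroup_kernel that] assms] free_lift_kernel[OF that]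
      h.hom_closed[OF assms]
    by simp
  then have "free_lift G f ` (K #>\<^bsub>F\<^esub> c) = {free_lift G f c}"
    using subgroup.one_closed[OF subgroup_kernel]
    by (auto simp: r_coset_def image_UN intro!: bexI[of _ "\<one>\<^bsub>F\<^esub>"])
  then show ?thesis
    by (simp add: tensor_lift_def)
qed

lemma tensor_lift_pure:
  "u \<in> carrier M \<Longrightarrow> v \<in> carrier N \<Longrightarrow> tensor_lift G f (pure u v) = f u v"
  by (simp add: pure_tensor_def tensor_lift_coset free_lift_frag)

lemma tensor_lift_closed: "X \<in> carrier T \<Longrightarrow> tensor_lift G f X \<in> carrier G"
  using h.hom_closed by (auto simp: carrier_T tensor_lift_coset)

lemma tensor_lift_add:
  assumes "X \<in> carrier T" "Y \<in> carrier T"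
  shows "tensor_lift G f (X \<oplus>\<^bsub>T\<^esub> Y) = tensor_lift G f X \<otimes>\<^bsub>G\<^esub> tensor_lift G f Y"
proof -
  obtain c d where "c \<in> carrier F" "d \<in> carrier F" "X = K #>\<^bsub>F\<^esub> c" "Y = K #>\<^bsub>F\<^esub> d"
    using assms by (auto simp: carrier_T)
  then show ?thesis
    using h.hom_mult[of c d] F.m_closed[of c d] by (simp add: coset_add tensor_lift_coset free_plus)
qed

end

text \<open>Serves to push \<open>p_l \<otimes> 1\<close> through the sum that defines the
  connection. The target is an \<open>add_monoid\<close>, so that the image is again a
  \<open>finsum\<close>.\<close>

lemma tensor_lift_finsum:
  assumes B: "abelian_group B" and bal: "balanced_map (add_monoid B) f"
    and "finite J" "X \<in> J \<rightarrow> carrier T"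
  shows "tensor_lift (add_monoid B) f (finsum T X J) = finsum B (\<lambda>i. tensor_lift (add_monoid B) f (X i)) J"
proof -
  interpret B: abelian_group B by (rule B)
  note lift = tensor_lift_closed[OF B.a_comm_group bal, simplified]
    tensor_lift_add[OF B.a_comm_group bal, simplified]
  \<comment> \<open>Additivity alone gives \<open>z + z = z\<close> for the image \<open>z\<close>
    of zero; cancellation then yields \<open>z = 0\<close>.\<close>
  have "tensor_lift (add_monoid B) f \<zero>\<^bsub>T\<^esub> \<oplus>\<^bsub>B\<^esub> tensor_lift (add_monoid B) f \<zero>\<^bsub>T\<^esub>
      = tensor_lift (add_monoid B) f \<zero>\<^bsub>T\<^esub>"
    by (simp flip: lift(2))
  then have zero: "tensor_lift (add_monoid B) f \<zero>\<^bsub>T\<^esub> = \<zero>\<^bsub>B\<^esub>"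
    using lift(1)[OF T.zero_closed] by (metis B.add.r_cancel_one)
  show ?thesis
    using assms(3,4)
    by (induction J rule: finite_induct) (simp_all add: zero lift T.finsum_insert B.finsum_insert Pi_iff)
qed

section \<open>Scalar multiplication on the tensor product\<close>

lemma balanced_smult:
  assumes "r \<in> carrier R"
  shows "balanced_map (tensor_group R M N) (\<lambda>u v. pure (r \<odot>\<^bsub>M\<^esub> u) v)"
proof -
  have "pure (r \<odot>\<^bsub>M\<^esub> (s \<odot>\<^bsub>M\<^esub> u)) v = pure (r \<odot>\<^bsub>M\<^esub> u) (s \<odot>\<^bsub>N\<^esub> v)"
    if "s \<in> carrier R" "u \<in> carrier M" "v \<in> carrier N" for s u v
  proof -
    \<comment> \<open>Commutativity of \<open>R\<close> brings \<open>s\<close> to the outside,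
      where it can cross the tensor sign.\<close>
    have "r \<odot>\<^bsub>M\<^esub> (s \<odot>\<^bsub>M\<^esub> u) = s \<odot>\<^bsub>M\<^esub> (r \<odot>\<^bsub>M\<^esub> u)"
      using assms that by (simp add: M.R.m_comm flip: M.smult_assoc1)
    then show ?thesis
      using assms that by (simp add: pure_balanced)
  qed
  then show ?thesis
    using assms by (auto simp: balanced_map_def M.smult_r_distr pure_add_l pure_add_r)
qed

lemma smult_eq: "r \<odot>\<^bsub>T\<^esub> X = tensor_lift (tensor_group R M N) (\<lambda>u v. pure (r \<odot>\<^bsub>M\<^esub> u) v) X"
  by (simp add: tensor_module_def del: tensor_group_simps)

lemma smult_pure [simp]:
  assumes "r \<in> carrier R" "u \<in> carrier M" "v \<in> carrier N"
  shows "r \<odot>\<^bsub>T\<^esub> pure u v = pure (r \<odot>\<^bsub>M\<^esub> u) v"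
  using assms by (simp add: smult_eq tensor_lift_pure[OF comm_group_tensor_group balanced_smult])

lemma smult_tensor_closed: "r \<in> carrier R \<Longrightarrow> X \<in> carrier T \<Longrightarrow> r \<odot>\<^bsub>T\<^esub> X \<in> carrier T"
  using tensor_lift_closed[OF comm_group_tensor_group balanced_smult] by (simp add: smult_eq)

lemma smult_tensor_add:
  "r \<in> carrier R \<Longrightarrow> X \<in> carrier T \<Longrightarrow> Y \<in> carrier T \<Longrightarrow>
    r \<odot>\<^bsub>T\<^esub> (X \<oplus>\<^bsub>T\<^esub> Y) = r \<odot>\<^bsub>T\<^esub> X \<oplus>\<^bsub>T\<^esub> r \<odot>\<^bsub>T\<^esub> Y"
  using tensor_lift_add[OF comm_group_tensor_group balanced_smult] by (simp add: smult_eq)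

text \<open>\<open>smult_tensor_add\<close> makes both sides of the remaining axioms additive in
  \<open>X\<close>, so \<open>tensor_induct\<close> reduces them to pure tensors, where they come
  from \<open>M\<close>.\<close>

lemma module_tensor: "module R T"
proof (rule moduleI)
  fix a b X assume ab: "a \<in> carrier R" "b \<in> carrier R" and X: "X \<in> carrier T"
  from X show "(a \<oplus> b) \<odot>\<^bsub>T\<^esub> X = a \<odot>\<^bsub>T\<^esub> X \<oplus>\<^bsub>T\<^esub> b \<odot>\<^bsub>T\<^esub> X"
  proof (induction rule: tensor_induct)
    case (pure u v)
    then show ?case using ab by (simp add: M.smult_l_distr pure_add_l)
  next
    case (add X Y)
    then show ?case using ab by (simp add: smult_tensor_add smult_tensor_closed T.a_ac)
  qed
  from X show "(a \<otimes> b) \<odot>\<^bsub>T\<^esub> X = a \<odot>\<^bsub>T\<^esub> (b \<odot>\<^bsub>T\<^esub> X)"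
  proof (induction rule: tensor_induct)
    case (pure u v)
    then show ?case using ab by (simp add: M.smult_assoc1)
  next
    case (add X Y)
    then show ?case using ab by (simp add: smult_tensor_add smult_tensor_closed)
  qed
next
  fix X assume "X \<in> carrier T"
  then show "\<one> \<odot>\<^bsub>T\<^esub> X = X"
    by (induction rule: tensor_induct) (simp_all add: smult_tensor_add)
qed (auto intro: M.R.cring_axioms T.abelian_group_axioms simp: smult_tensor_closed smult_tensor_add)

end

section \<open>The tensor product of two algebras\<close>

lemma (in algebra) smult_assoc2':
  assumes "a \<in> carrier R" "x \<in> carrier M" "y \<in> carrier M"
  shows "x \<otimes>\<^bsub>M\<^esub> (a \<odot>\<^bsub>M\<^esub> y) = a \<odot>\<^bsub>M\<^esub> (x \<otimes>\<^bsub>M\<^esub> y)"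
  using assms smult_assoc2[of a y x] m_comm[of x "a \<odot>\<^bsub>M\<^esub> y"] m_comm[of y x] by simp

locale algebra_tensor_product = M: algebra R M + N: algebra R N
  for R :: "('r, 'p) ring_scheme" (structure) and M :: "('r, 'm) module" and N :: "('r, 'n) module"
begin

sublocale tensor_product R M N
  by unfold_locales

abbreviation "TA \<equiv> tensor_algebra R M N"

lemma carrier_TA [simp]: "carrier TA = carrier T"
  and add_TA [simp]: "X \<oplus>\<^bsub>TA\<^esub> Y = X \<oplus>\<^bsub>T\<^esub> Y"
  and zero_TA [simp]: "\<zero>\<^bsub>TA\<^esub> = \<zero>\<^bsub>T\<^esub>"
  and one_TA: "\<one>\<^bsub>TA\<^esub> = pure \<one>\<^bsub>M\<^esub> \<one>\<^bsub>N\<^esub>"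
  by (simp_all add: tensor_algebra_def)

lemma add_monoid_TA: "add_monoid TA = add_monoid T"
  by (simp add: tensor_algebra_def)

text \<open>Being an abelian group depends only on the additive monoid, which \<open>TA\<close>
  shares with \<open>T\<close>.\<close>

lemma abelian_group_TA: "abelian_group TA"
  using T.abelian_group_axioms
  by (simp only: abelian_group_def abelian_monoid_def abelian_group_axioms_def add_monoid_TA)

abbreviation (input) "pure_mult u v \<equiv> (\<lambda>u' v'. pure (u \<otimes>\<^bsub>M\<^esub> u') (v \<otimes>\<^bsub>N\<^esub> v'))"

lemma balanced_pure_mult:
  assumes "u \<in> carrier M" "v \<in> carrier N"
  shows "balanced_map (tensor_group R M N) (pure_mult u v)"
  using assms
  by (simp add: balanced_map_def M.r_distr N.r_distr pure_add_l pure_add_r M.smult_assoc2'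
      N.smult_assoc2' pure_balanced)

lemmas lift_pure_mult = tensor_lift_pure[OF comm_group_tensor_group balanced_pure_mult]
  tensor_lift_add[OF comm_group_tensor_group balanced_pure_mult, simplified]
  tensor_lift_closed[OF comm_group_tensor_group balanced_pure_mult, simplified]

text \<open>The product is a lift over \<open>X\<close> of a lift over \<open>Y\<close>, and the
  outer lift needs this for arbitrary \<open>Y\<close>. Pure \<open>Y\<close> reduces to the laws of
  the two algebras; for a sum, the two balanced maps are added pointwise.\<close>

lemma balanced_mult:
  assumes "Y \<in> carrier T"
  shows "balanced_map (tensor_group R M N) (\<lambda>u v. tensor_lift (tensor_group R M N) (pure_mult u v) Y)"
  using assms
proof (induction rule: tensor_induct)
  case (pure u' v')
  then show ?case
    by (simp add: balanced_map_def lift_pure_mult M.l_distr N.l_distr pure_add_l pure_add_r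
        M.smult_assoc2 N.smult_assoc2 pure_balanced)
next
  case (add Y Z)
  then show ?case
    by (simp add: balanced_map_def lift_pure_mult T.a_ac)
qed

lemma mult_eq:
  "X \<otimes>\<^bsub>TA\<^esub> Y = tensor_lift (tensor_group R M N) (\<lambda>u v. tensor_lift (tensor_group R M N) (pure_mult u v) Y) X"
  by (simp add: tensor_algebra_def)

lemma mult_pure [simp]:
  assumes "u \<in> carrier M" "v \<in> carrier N" "u' \<in> carrier M" "v' \<in> carrier N"
  shows "pure u v \<otimes>\<^bsub>TA\<^esub> pure u' v' = pure (u \<otimes>\<^bsub>M\<^esub> u') (v \<otimes>\<^bsub>N\<^esub> v')"
  using assms by (simp add: mult_eq tensor_lift_pure[OF comm_group_tensor_group balanced_mult] lift_pure_mult)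

lemma mult_closed: "X \<in> carrier T \<Longrightarrow> Y \<in> carrier T \<Longrightarrow> X \<otimes>\<^bsub>TA\<^esub> Y \<in> carrier T"
  using tensor_lift_closed[OF comm_group_tensor_group balanced_mult] by (simp add: mult_eq)

lemma mult_l_distr:
  "X \<in> carrier T \<Longrightarrow> Y \<in> carrier T \<Longrightarrow> Z \<in> carrier T \<Longrightarrow>
    (X \<oplus>\<^bsub>T\<^esub> Y) \<otimes>\<^bsub>TA\<^esub> Z = X \<otimes>\<^bsub>TA\<^esub> Z \<oplus>\<^bsub>T\<^esub> Y \<otimes>\<^bsub>TA\<^esub> Z"
  using tensor_lift_add[OF comm_group_tensor_group balanced_mult] by (simp add: mult_eq)

text \<open>Additivity of the outer lift gives only distributivity in the left factor. For pure
  \<open>X\<close> the product is the inner lift at \<open>Y\<close>, which is additive as well;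
  sums in \<open>X\<close> follow by \<open>mult_l_distr\<close>.\<close>

lemma mult_r_distr:
  assumes "X \<in> carrier T" and Y: "Y \<in> carrier T" "Z \<in> carrier T"
  shows "X \<otimes>\<^bsub>TA\<^esub> (Y \<oplus>\<^bsub>T\<^esub> Z) = X \<otimes>\<^bsub>TA\<^esub> Y \<oplus>\<^bsub>T\<^esub> X \<otimes>\<^bsub>TA\<^esub> Z"
  using assms(1)
proof (induction rule: tensor_induct)
  case (pure u v)
  then show ?case
    using Y by (simp add: mult_eq tensor_lift_pure[OF comm_group_tensor_group balanced_mult] lift_pure_mult)
next
  case (add U V)
  then show ?case
    using Y by (simp add: mult_l_distr mult_closed T.a_ac)
qed

lemma mult_comm:
  assumes "X \<in> carrier T" and Y: "Y \<in> carrier T"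
  shows "X \<otimes>\<^bsub>TA\<^esub> Y = Y \<otimes>\<^bsub>TA\<^esub> X"
  using assms(1)
proof (induction rule: tensor_induct)
  case (pure u v)
  from Y show ?case
    by (induction rule: tensor_induct) 
      (use pure in \<open>simp_all add: mult_l_distr mult_r_distr M.m_comm N.m_comm\<close>)
next
  case (add U V)
  then show ?case
    using Y by (simp add: mult_l_distr mult_r_distr)
qed

lemma mult_assoc:
  assumes "X \<in> carrier T" and Y: "Y \<in> carrier T" and Z: "Z \<in> carrier T"
  shows "X \<otimes>\<^bsub>TA\<^esub> Y \<otimes>\<^bsub>TA\<^esub> Z = X \<otimes>\<^bsub>TA\<^esub> (Y \<otimes>\<^bsub>TA\<^esub> Z)"
  using assms(1)
proof (induction rule: tensor_induct)
  case X: (pure u v)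
  from Y show ?case
  proof (induction rule: tensor_induct)
    case Y: (pure u' v')
    from Z show ?case
      by (induction rule: tensor_induct) 
        (use X Y in \<open>simp_all add: mult_r_distr mult_closed M.m_assoc N.m_assoc\<close>)
  next
    case (add U V)
    then show ?case
      using X Z by (simp add: mult_l_distr mult_r_distr mult_closed)
  qed
next
  case (add U V)
  then show ?case
    using Y Z by (simp add: mult_l_distr mult_closed)
qed

lemma one_closed: "\<one>\<^bsub>TA\<^esub> \<in> carrier T"
  by (simp add: one_TA)

lemma mult_one:
  assumes "X \<in> carrier T"
  shows "\<one>\<^bsub>TA\<^esub> \<otimes>\<^bsub>TA\<^esub> X = X"
  using assms by (induction rule: tensor_induct) (simp_all add: one_TA mult_r_distr)

lemma cring_TA: "cring TA"
proof (rule cringI)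
  show "comm_monoid TA"
    by (rule comm_monoidI, simp_all add: mult_closed mult_assoc mult_one one_closed) (rule mult_comm)
qed (simp_all add: abelian_group_TA mult_l_distr)

sublocale TA: cring TA
  by (rule cring_TA)

text \<open>Statements about the ring are kept in terms of \<open>TA\<close>, since the ring and ideal lemmas speak of it.\<close>

declare carrier_TA [simp del] add_TA [simp del] zero_TA [simp del]

lemmas TA_pure_closed [simp, intro] = pure_closed[folded carrier_TA]
lemmas TA_pure_add_l = pure_add_l[folded add_TA]
lemmas TA_pure_add_r = pure_add_r[folded add_TA]
lemmas TA_induct [consumes 1, case_names pure add] = tensor_induct[folded carrier_TA add_TA]

end

section \<open>Principal parts\<close>

locale algebra_square = algebra k A
  for k :: "('k, 'p) ring_scheme" and A :: "('k, 'a) module" (structure)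
begin

sublocale sq: algebra_tensor_product k A A
  by unfold_locales

abbreviation "S \<equiv> tensor_algebra k A A"
abbreviation "pure \<equiv> pure_tensor k A A"
abbreviation "\<mu> \<equiv> multiplication_map A"

section \<open>The multiplication map and its kernel\<close>

lemma balanced_multiplication: "sq.balanced_map (add_monoid A) (\<lambda>a b. a \<otimes> b)"
  by (simp add: sq.balanced_map_def l_distr r_distr smult_assoc2 smult_assoc2')

lemmas multiplication_map_simps =
  sq.tensor_lift_pure[OF a_comm_group balanced_multiplication, folded multiplication_map_def]
  sq.tensor_lift_closed[OF a_comm_group balanced_multiplication, folded multiplication_map_def sq.carrier_TA, simplified]
  sq.tensor_lift_add[OF a_comm_group balanced_multiplication, folded multiplication_map_def sq.carrier_TA sq.add_TA, simplified]

text \<open>Both sides are additive in \<open>X\<close> and in \<open>Y\<close>. For pure tensors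
  the identity is a rearrangement of four factors in the commutative ring \<open>A\<close>.\<close>

lemma multiplication_map_mult:
  assumes "X \<in> carrier S" and Y: "Y \<in> carrier S"
  shows "\<mu> (X \<otimes>\<^bsub>S\<^esub> Y) = \<mu> X \<otimes> \<mu> Y"
  using assms(1)
proof (induction rule: sq.TA_induct)
  case (pure u v)
  from Y show ?case
    by (induction rule: sq.TA_induct)
      (use pure in \<open>simp_all add: multiplication_map_simps sq.TA.r_distr r_distr m_ac\<close>)
next
  case (add U V)
  then show ?case
    using Y by (simp add: multiplication_map_simps sq.TA.l_distr l_distr)
qed

lemma ring_hom_multiplication: "ring_hom_ring S A \<mu>"
proof (rule ring_hom_ringI)
  show "\<mu> \<one>\<^bsub>S\<^esub> = \<one>"
    by (simp add: sq.one_TA multiplication_map_simps)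
qed (simp_all add: multiplication_map_simps multiplication_map_mult sq.TA.ring_axioms ring_axioms)

abbreviation "I \<equiv> diagonal_ideal k A"
abbreviation "Ipow j \<equiv> I [^]\<^bsub>ideals_set S\<^esub> (j :: nat)"

lemma ideal_diagonal: "ideal I S"
  unfolding diagonal_ideal_def by (rule ring_hom_ring.kernel_is_ideal[OF ring_hom_multiplication])

text \<open>Multiplication by this element measures how far the actions of \<open>a\<close> on
  \<open>S\<close> through the right and the left factor are apart. Each commutator multiplies the
  twist by it.\<close>

definition delta :: "'a \<Rightarrow> ('a \<times> 'a \<Rightarrow>\<^sub>0 int) set"
  where "delta a = pure \<one> a \<ominus>\<^bsub>S\<^esub> pure a \<one>"

lemma delta_closed [simp, intro]: "a \<in> carrier A \<Longrightarrow> delta a \<in> carrier S"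
  by (simp add: delta_def)

lemma delta_add: "a \<in> carrier A \<Longrightarrow> delta a \<oplus>\<^bsub>S\<^esub> pure a \<one> = pure \<one> a"
  by (simp add: delta_def a_minus_def sq.TA.a_assoc sq.TA.l_neg)

text \<open>\<open>\<mu>\<close> sends both \<open>1 \<otimes> a\<close> and
  \<open>a \<otimes> 1\<close> to \<open>a\<close>. With \<open>delta_add\<close> this reads
  \<open>\<mu> (delta a) \<oplus> a = a\<close>.\<close>

lemma delta_in_diagonal:
  assumes a: "a \<in> carrier A"
  shows "delta a \<in> I"
proof -
  have "\<mu> (delta a) \<oplus> a = \<mu> (delta a \<oplus>\<^bsub>S\<^esub> pure a \<one>)"
    using a by (simp add: multiplication_map_simps)
  also have "\<dots> = a"
    using a by (simp add: delta_add multiplication_map_simps)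
  finally have "\<mu> (delta a) = \<zero>"
    using a by (metis add.r_cancel_one delta_closed multiplication_map_simps(2))
  then show ?thesis
    using a by (simp add: diagonal_ideal_def a_kernel_def')
qed

lemma ideal_Ipow: "ideal (Ipow j) S"
proof -
  \<comment> \<open>Ideals form a semiring under sum and product; its multiplicative monoid is
    closed under powers.\<close>
  interpret semiring "ideals_set S" by (rule sq.TA.ideals_set_is_semiring)
  have "I \<in> carrier (ideals_set S)"
    by (simp add: ideals_set_def ideal_diagonal)
  then have "Ipow j \<in> carrier (ideals_set S)"
    by (rule nat_pow_closed)
  then show ?thesis
    by (simp add: ideals_set_def)
qed

text \<open>The unit of the ideal product is the whole ring. The chain of twists starts here, with
  the unit of \<open>S\<close>.\<close>

lemma Ipow_0: "Ipow 0 = carrier S"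
  by (simp add: nat_pow_def ideals_set_def)

lemma Ipow_Suc: "Ipow (Suc j) = ideal_prod S (Ipow j) I"
  by (simp add: nat_pow_def ideals_set_def)

lemma Ipow_Suc_subset: "Ipow (Suc j) \<subseteq> Ipow j"
  unfolding Ipow_Suc using sq.TA.ideal_prod_inter[OF ideal_Ipow ideal_diagonal] by blast

lemma Ipow_mult_delta: "s \<in> Ipow j \<Longrightarrow> a \<in> carrier A \<Longrightarrow> s \<otimes>\<^bsub>S\<^esub> delta a \<in> Ipow (Suc j)"
  unfolding Ipow_Suc by (intro ideal_prod.prod delta_in_diagonal)

section \<open>The modules of principal parts and their projections\<close>

abbreviation "P l \<equiv> principal_parts k A l"
abbreviation "cl \<equiv> parts_class k A"

lemma ideal_parts: "ideal (parts_ideal k A l) S"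
  unfolding parts_ideal_def by (rule ideal_Ipow)

lemma carrier_parts: "carrier (P l) = cl l ` carrier S"
  by (auto simp: principal_parts_def Let_def FactRing_def A_RCOSETS_def' parts_class_def)

lemma parts_class_closed [simp, intro]: "t \<in> carrier S \<Longrightarrow> cl l t \<in> carrier (P l)"
  by (simp add: carrier_parts)

lemma parts_class_add:
  assumes "s \<in> carrier S" "t \<in> carrier S"
  shows "cl l (s \<oplus>\<^bsub>S\<^esub> t) = cl l s \<oplus>\<^bsub>P l\<^esub> cl l t"
  using ideal.a_rcos_sum[OF ideal_parts assms, of l]
  by (simp add: principal_parts_def Let_def FactRing_def parts_class_def)

lemma parts_class_eq_zero:
  assumes "t \<in> parts_ideal k A l"
  shows "cl l t = \<zero>\<^bsub>P l\<^esub>"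
  using ideal.Icarr[OF ideal_parts assms]
    sq.TA.a_coset_join2[OF _ additive_subgroup.a_subgroup[OF ideal.axioms(1)[OF ideal_parts]] assms]
  by (simp add: principal_parts_def Let_def FactRing_def parts_class_def)

lemma parts_class_memE:
  assumes "t' \<in> cl l t"
  obtains j where "j \<in> parts_ideal k A l" "t' = j \<oplus>\<^bsub>S\<^esub> t"
  using assms by (auto simp: parts_class_def a_r_coset_def')

lemma parts_class_self:
  assumes "t \<in> carrier S"
  shows "t \<in> cl l t"
proof -
  have "\<zero>\<^bsub>S\<^esub> \<in> parts_ideal k A l"
    by (rule additive_subgroup.zero_closed[OF ideal.axioms(1)[OF ideal_parts]])
  then show ?thesis
    using assms unfolding parts_class_def a_r_coset_def' by force
qed

text \<open>Independence of the representative: this is what makes the unions in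
  \<open>principal_parts\<close> and \<open>parts_projection\<close> unions of a single
  class.\<close>

lemma parts_class_absorb:
  assumes j: "j \<in> parts_ideal k A l" and t: "t \<in> carrier S"
  shows "cl l (j \<oplus>\<^bsub>S\<^esub> t) = cl l t"
proof -
  have "j \<oplus>\<^bsub>S\<^esub> t \<in> parts_ideal k A l +>\<^bsub>S\<^esub> t"
    using j unfolding a_r_coset_def' by blast
  then show ?thesis
    unfolding parts_class_def
    using sq.TA.a_repr_independence t additive_subgroup.a_subgroup[OF ideal.axioms(1)[OF ideal_parts]]
    by metis
qed

lemma parts_zero: "\<zero>\<^bsub>P l\<^esub> = cl l \<zero>\<^bsub>S\<^esub>"
  by (rule parts_class_eq_zero[symmetric])
    (rule additive_subgroup.zero_closed[OF ideal.axioms(1)[OF ideal_parts]])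

lemma abelian_group_parts: "abelian_group (P l)"
proof (rule abelian_groupI)
  fix X assume "X \<in> carrier (P l)"
  then obtain t where t: "t \<in> carrier S" "X = cl l t"
    by (auto simp: carrier_parts)
  then have "cl l (\<ominus>\<^bsub>S\<^esub> t) \<oplus>\<^bsub>P l\<^esub> X = \<zero>\<^bsub>P l\<^esub>"
    by (simp add: parts_zero sq.TA.l_neg flip: parts_class_add)
  then show "\<exists>Y\<in>carrier (P l). Y \<oplus>\<^bsub>P l\<^esub> X = \<zero>\<^bsub>P l\<^esub>"
    using t by (intro bexI[of _ "cl l (\<ominus>\<^bsub>S\<^esub> t)"]) auto
qed (auto simp: carrier_parts parts_zero sq.TA.a_ac simp flip: parts_class_add)

text \<open>Rewrites the lift in the definition of the scalar action as multiplication in the ring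
  \<open>S\<close>, so that ideal closure applies to it.\<close>

lemma lift_left_mult:
  assumes a: "a \<in> carrier A" and "t \<in> carrier S"
  shows "tensor_lift (add_monoid S) (\<lambda>b c. pure (a \<otimes> b) c) t = pure a \<one> \<otimes>\<^bsub>S\<^esub> t"
proof -
  have bal: "sq.balanced_map (add_monoid S) (\<lambda>b c. pure (a \<otimes> b) c)"
    using a by (simp add: sq.balanced_map_def r_distr sq.TA_pure_add_l sq.TA_pure_add_r
        smult_assoc2' sq.pure_balanced)
  note lift = sq.tensor_lift_pure[OF sq.TA.a_comm_group bal]
    sq.tensor_lift_add[OF sq.TA.a_comm_group bal, folded sq.carrier_TA sq.add_TA, simplified]
  show ?thesis
    using assms(2) by (induction rule: sq.TA_induct) (use a in \<open>simp_all add: lift sq.TA.r_distr\<close>)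
qed

lemma smult_parts:
  assumes a: "a \<in> carrier A" and t: "t \<in> carrier S"
  shows "a \<odot>\<^bsub>P l\<^esub> cl l t = cl l (pure a \<one> \<otimes>\<^bsub>S\<^esub> t)"
proof -
  have "cl l (tensor_lift (add_monoid S) (\<lambda>b c. pure (a \<otimes> b) c) t') = cl l (pure a \<one> \<otimes>\<^bsub>S\<^esub> t)"
    if t': "t' \<in> cl l t" for t'
  proof -
    obtain j where j: "j \<in> parts_ideal k A l" "t' = j \<oplus>\<^bsub>S\<^esub> t"
      using t' by (rule parts_class_memE)
    \<comment> \<open>The representatives \<open>t'\<close> and \<open>t\<close> differ by
      \<open>j\<close>; their images differ by \<open>(a \<otimes> 1) j\<close>, which stays in the
      ideal.\<close>
    have "pure a \<one> \<otimes>\<^bsub>S\<^esub> j \<in> parts_ideal k A l"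
      using a j by (intro ideal.I_l_closed[OF ideal_parts]) auto
    then show ?thesis
      using a t j ideal.Icarr[OF ideal_parts j(1)]
      by (simp add: lift_left_mult sq.TA.r_distr parts_class_absorb)
  qed
  then show ?thesis
    using parts_class_self[OF t] by (auto simp: principal_parts_def Let_def)
qed

text \<open>By \<open>smult_parts\<close> the scalar \<open>a\<close> acts as
  \<open>a \<otimes> 1\<close>, and \<open>a \<mapsto> a \<otimes> 1\<close> respects sums, products
  and the unit. The axioms become ring identities in \<open>S\<close> between
  representatives.\<close>

lemma module_parts: "module A (P l)"
proof (rule moduleI)
  show "cring A" by (rule is_cring)
  show "abelian_group (P l)" by (rule abelian_group_parts)
next
  fix a X assume a: "a \<in> carrier A" and "X \<in> carrier (P l)"
  then obtain t where t: "t \<in> carrier S" "X = cl l t"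
    by (auto simp: carrier_parts)
  show "a \<odot>\<^bsub>P l\<^esub> X \<in> carrier (P l)"
    using a t by (simp add: smult_parts)
  show "(a \<oplus> b) \<odot>\<^bsub>P l\<^esub> X = a \<odot>\<^bsub>P l\<^esub> X \<oplus>\<^bsub>P l\<^esub> b \<odot>\<^bsub>P l\<^esub> X"
    if "b \<in> carrier A" for b
    using a t that by (simp add: smult_parts sq.TA_pure_add_l sq.TA.l_distr parts_class_add)
  show "a \<odot>\<^bsub>P l\<^esub> (X \<oplus>\<^bsub>P l\<^esub> Y) = a \<odot>\<^bsub>P l\<^esub> X \<oplus>\<^bsub>P l\<^esub> a \<odot>\<^bsub>P l\<^esub> Y"
    if Y: "Y \<in> carrier (P l)" for Y
  proof -
    obtain s where "s \<in> carrier S" "Y = cl l s"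
      using Y by (auto simp: carrier_parts)
    then show ?thesis
      using a t by (simp add: smult_parts sq.TA.r_distr flip: parts_class_add)
  qed
  show "(a \<otimes> b) \<odot>\<^bsub>P l\<^esub> X = a \<odot>\<^bsub>P l\<^esub> (b \<odot>\<^bsub>P l\<^esub> X)" if "b \<in> carrier A" for b
    using a t that by (simp add: smult_parts flip: sq.TA.m_assoc)
next
  fix X assume "X \<in> carrier (P l)"
  then obtain t where t: "t \<in> carrier S" "X = cl l t"
    by (auto simp: carrier_parts)
  then show "\<one> \<odot>\<^bsub>P l\<^esub> X = X"
    by (simp add: smult_parts flip: sq.one_TA)
qed

text \<open>For \<open>l \<ge> 1\<close> the two ideals are \<open>Ipow (l + 1)\<close> and
  \<open>Ipow l\<close>. The inclusion makes the projection well defined.\<close>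

lemma parts_ideal_subset: "l \<ge> 1 \<Longrightarrow> parts_ideal k A l \<subseteq> parts_ideal k A (l - 1)"
  using Ipow_Suc_subset[of l] by (simp add: parts_ideal_def)

lemma parts_projection_class:
  assumes "l \<ge> 1" and t: "t \<in> carrier S"
  shows "parts_projection k A l (cl l t) = cl (l - 1) t"
proof -
  have "cl (l - 1) t' = cl (l - 1) t" if "t' \<in> cl l t" for t'
    using that parts_ideal_subset[OF assms(1)] t
    by (auto elim!: parts_class_memE intro!: parts_class_absorb)
  then show ?thesis
    using parts_class_self[OF t] unfolding parts_projection_def by blast
qed

text \<open>These three facts make \<open>(s, u) \<mapsto> p_l(s) \<otimes> u\<close> balanced over
  \<open>A\<close>, so that \<open>p_l \<otimes> 1\<close> exists.\<close>

lemma parts_projection_linear: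
  assumes "l \<ge> 1" "X \<in> carrier (P l)"
  shows "parts_projection k A l X \<in> carrier (P (l - 1))"
    and "Y \<in> carrier (P l) \<Longrightarrow> parts_projection k A l (X \<oplus>\<^bsub>P l\<^esub> Y)
      = parts_projection k A l X \<oplus>\<^bsub>P (l - 1)\<^esub> parts_projection k A l Y"
    and "a \<in> carrier A \<Longrightarrow> parts_projection k A l (a \<odot>\<^bsub>P l\<^esub> X)
      = a \<odot>\<^bsub>P (l - 1)\<^esub> parts_projection k A l X"
proof -
  obtain t where t: "t \<in> carrier S" "X = cl l t"
    using assms by (auto simp: carrier_parts)
  show "parts_projection k A l X \<in> carrier (P (l - 1))"
    using t by (simp add: parts_projection_class[OF assms(1)])
  show "parts_projection k A l (X \<oplus>\<^bsub>P l\<^esub> Y)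
      = parts_projection k A l X \<oplus>\<^bsub>P (l - 1)\<^esub> parts_projection k A l Y"
    if Y: "Y \<in> carrier (P l)"
  proof -
    obtain s where "s \<in> carrier S" "Y = cl l s"
      using Y by (auto simp: carrier_parts)
    then show ?thesis
      using t by (simp add: parts_projection_class[OF assms(1)] flip: parts_class_add)
  qed
  show "parts_projection k A l (a \<odot>\<^bsub>P l\<^esub> X) = a \<odot>\<^bsub>P (l - 1)\<^esub> parts_projection k A l X"
    if "a \<in> carrier A"
    using t that by (simp add: parts_projection_class[OF assms(1)] smult_parts)
qed

end

section \<open>The connection\<close>

locale projective_connection = algebra_square k A + E: module A E
  for k :: "('k, 'p) ring_scheme" and A :: "('k, 'a) module" (structure) and E :: "('a, 'e) module" +
  fixes n :: nat and e :: "nat \<Rightarrow> 'e" and x :: "nat \<Rightarrow> 'e \<Rightarrow> 'a"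
  assumes basis: "projective_basis A E n e x"
begin

lemma tensor_product_parts: "tensor_product A (P l) E"
  using module_parts E.module_axioms by (simp add: tensor_product_def)

text \<open>The order stays a parameter, so that the facts apply to orders \<open>l\<close> and
  \<open>l - 1\<close> alike.\<close>

sublocale pt: tensor_product A "P l" E for l
  by (rule tensor_product_parts)

abbreviation "W l \<equiv> tensor_module A (P l) E"

lemma e_closed [simp]: "i \<in> {1..n} \<Longrightarrow> e i \<in> carrier E"
  using basis by (simp add: projective_basis_def)

lemma
  assumes "i \<in> {1..n}"
  shows x_closed [simp]: "u \<in> carrier E \<Longrightarrow> x i u \<in> carrier A"
    and x_add: "u \<in> carrier E \<Longrightarrow> v \<in> carrier E \<Longrightarrow> x i (u \<oplus>\<^bsub>E\<^esub> v) = x i u \<oplus> x i v"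
    and x_smult: "a \<in> carrier A \<Longrightarrow> u \<in> carrier E \<Longrightarrow> x i (a \<odot>\<^bsub>E\<^esub> u) = a \<otimes> x i u"
  using basis assms by (auto simp: projective_basis_def module_Hom_def regular_module_def)

text \<open>The twist is an element of \<open>S\<close>, not a class modulo an ideal, so that the
  power of \<open>I\<close> containing it can be tracked.\<close>

definition twisted_connection ::
  "nat \<Rightarrow> ('a \<times> 'a \<Rightarrow>\<^sub>0 int) set \<Rightarrow> 'e \<Rightarrow> (('a \<times> 'a \<Rightarrow>\<^sub>0 int) set set \<times> 'e \<Rightarrow>\<^sub>0 int) set"
  where "twisted_connection l s u =
    finsum (W l) (\<lambda>i. pure_tensor A (P l) E (cl l (s \<otimes>\<^bsub>S\<^esub> pure \<one> (x i u))) (e i)) {1..n}"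

lemma twisted_connection_closed [simp, intro]:
  "s \<in> carrier S \<Longrightarrow> u \<in> carrier E \<Longrightarrow> twisted_connection l s u \<in> carrier (W l)"
  unfolding twisted_connection_def by (intro pt.T.finsum_closed) auto

lemma twisted_connection_one:
  assumes "u \<in> carrier E"
  shows "parts_connection k A E n e x l u = twisted_connection l \<one>\<^bsub>S\<^esub> u"
  unfolding twisted_connection_def parts_connection_def parts_tensor_def parts_universal_def
  using assms by (intro pt.T.finsum_cong') auto

text \<open>The ideal absorbs \<open>1 \<otimes> x_i(u)\<close>, so every left factor is the zero
  class and every summand vanishes.\<close>

lemma twisted_connection_zero:
  assumes "s \<in> parts_ideal k A l" "u \<in> carrier E"
  shows "twisted_connection l s u = \<zero>\<^bsub>W l\<^esub>"
proof -
  have "pure_tensor A (P l) E (cl l (s \<otimes>\<^bsub>S\<^esub> pure \<one> (x i u))) (e i) = \<zero>\<^bsub>W l\<^esub>" if "i \<in> {1..n}" for i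
    using assms that
    by (simp add: parts_class_eq_zero[OF ideal.I_r_closed[OF ideal_parts]])
  then show ?thesis
    unfolding twisted_connection_def by (intro pt.T.add.finprod_one_eqI) auto
qed

lemma twisted_connection_add:
  assumes "s \<in> carrier S" "u \<in> carrier E" "v \<in> carrier E"
  shows "twisted_connection l s (u \<oplus>\<^bsub>E\<^esub> v) = twisted_connection l s u \<oplus>\<^bsub>W l\<^esub> twisted_connection l s v"
proof -
  have "twisted_connection l s (u \<oplus>\<^bsub>E\<^esub> v) =
    finsum (W l) (\<lambda>i. pure_tensor A (P l) E (cl l (s \<otimes>\<^bsub>S\<^esub> pure \<one> (x i u))) (e i)
      \<oplus>\<^bsub>W l\<^esub> pure_tensor A (P l) E (cl l (s \<otimes>\<^bsub>S\<^esub> pure \<one> (x i v))) (e i)) {1..n}"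
    unfolding twisted_connection_def using assms
    by (intro pt.T.finsum_cong')
      (auto simp: x_add sq.TA_pure_add_r sq.TA.r_distr parts_class_add pt.pure_add_l)
  then show ?thesis
    unfolding twisted_connection_def using assms by (subst (asm) pt.T.finsum_addf) auto
qed

text \<open>Since \<open>x_i(a u) = a x_i(u)\<close>, the left factor acquires
  \<open>1 \<otimes> a = delta a + a \<otimes> 1\<close>. The first part changes the twist; the
  second is the action of \<open>a\<close> on \<open>P l\<close>, which comes out of the
  sum.\<close>

lemma twisted_connection_smult:
  assumes s: "s \<in> carrier S" and a: "a \<in> carrier A" and u: "u \<in> carrier E"
  shows "twisted_connection l s (a \<odot>\<^bsub>E\<^esub> u)
    = twisted_connection l (s \<otimes>\<^bsub>S\<^esub> delta a) u \<oplus>\<^bsub>W l\<^esub> a \<odot>\<^bsub>W l\<^esub> twisted_connection l s u"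
proof -
  have split: "s \<otimes>\<^bsub>S\<^esub> pure \<one> (a \<otimes> b)
      = (s \<otimes>\<^bsub>S\<^esub> delta a) \<otimes>\<^bsub>S\<^esub> pure \<one> b \<oplus>\<^bsub>S\<^esub> pure a \<one> \<otimes>\<^bsub>S\<^esub> (s \<otimes>\<^bsub>S\<^esub> pure \<one> b)"
    if b: "b \<in> carrier A" for b
  proof -
    have "pure \<one> (a \<otimes> b) = (delta a \<oplus>\<^bsub>S\<^esub> pure a \<one>) \<otimes>\<^bsub>S\<^esub> pure \<one> b"
      using a b by (simp add: delta_add)
    \<comment> \<open>\<open>sq.mult_pure\<close> is switched off so that
      \<open>pure a \<one>\<close> and \<open>pure \<one> b\<close> stay separate factors for
      distributivity and reordering.\<close>
    then show ?thesis
      using s a b by (simp add: sq.TA.l_distr sq.TA.r_distr sq.TA.m_ac del: sq.mult_pure)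
  qed
  let ?t = "\<lambda>s i. pure_tensor A (P l) E (cl l (s \<otimes>\<^bsub>S\<^esub> pure \<one> (x i u))) (e i)"
  have "twisted_connection l s (a \<odot>\<^bsub>E\<^esub> u)
      = finsum (W l) (\<lambda>i. ?t (s \<otimes>\<^bsub>S\<^esub> delta a) i \<oplus>\<^bsub>W l\<^esub> a \<odot>\<^bsub>W l\<^esub> ?t s i) {1..n}"
    unfolding twisted_connection_def using assms
    by (intro pt.T.finsum_cong')
      (auto simp: x_smult split parts_class_add pt.pure_add_l smult_parts)
  also have "\<dots> = finsum (W l) (?t (s \<otimes>\<^bsub>S\<^esub> delta a)) {1..n}
      \<oplus>\<^bsub>W l\<^esub> finsum (W l) (\<lambda>i. a \<odot>\<^bsub>W l\<^esub> ?t s i) {1..n}"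
    using assms by (intro pt.T.finsum_addf) (auto simp: pt.smult_tensor_closed)
  also have "finsum (W l) (\<lambda>i. a \<odot>\<^bsub>W l\<^esub> ?t s i) {1..n} = a \<odot>\<^bsub>W l\<^esub> finsum (W l) (?t s) {1..n}"
    using assms by (intro module.finsum_smult_ldistr[OF pt.module_tensor, symmetric]) auto
  finally show ?thesis
    by (simp add: twisted_connection_def)
qed

text \<open>Scalars from \<open>k\<close> cross the tensor sign over \<open>k\<close>, so
  \<open>1 \<otimes> c1\<close> and \<open>c1 \<otimes> 1\<close> agree. Hence commutators with
  \<open>c1\<close> vanish, which gives \<open>k\<close>-linearity of the connection.\<close>

lemma delta_scalar:
  assumes "c \<in> carrier k"
  shows "delta (c \<odot> \<one>) = \<zero>\<^bsub>S\<^esub>"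
  using assms by (simp add: delta_def sq.pure_balanced a_minus_def sq.TA.r_neg)

text \<open>\<open>Diff_shifted\<close> asks for \<open>k\<close>-linearity at each order, hence for
  all twists. Agreement of \<open>d\<close> on \<open>carrier E\<close> suffices, and commutators
  are identified with twisted connections only there.\<close>

lemma twisted_connection_Hom:
  assumes s: "s \<in> carrier S" and d: "\<And>u. u \<in> carrier E \<Longrightarrow> d u = twisted_connection l s u"
  shows "d \<in> module_Hom k (restrict_scalars A E) (restrict_scalars A (W l))"
proof -
  have "twisted_connection l s ((c \<odot> \<one>) \<odot>\<^bsub>E\<^esub> u) = (c \<odot> \<one>) \<odot>\<^bsub>W l\<^esub> twisted_connection l s u"
    if "c \<in> carrier k" "u \<in> carrier E" for c u
  proof -
    \<comment> \<open>For \<open>a = c1\<close> the new twist is \<open>s\<close> times zero, which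
      is zero. As zero lies in the ideal, the extra term of \<open>twisted_connection_smult\<close>
      vanishes.\<close>
    have "\<zero>\<^bsub>S\<^esub> \<in> parts_ideal k A l"
      by (rule additive_subgroup.zero_closed[OF ideal.axioms(1)[OF ideal_parts]])
    then show ?thesis
      using s that
      by (simp add: twisted_connection_smult delta_scalar twisted_connection_zero pt.smult_tensor_closed)
  qed
  then show ?thesis
    using s by (auto simp: module_Hom_def restrict_scalars_def d twisted_connection_add)
qed

text \<open>\<open>j\<close> counts the factors from \<open>I\<close> collected in the twist and
  \<open>m\<close> the commutators still to come, so \<open>j + m\<close> stays at
  \<open>l + 1\<close>. At \<open>m = 0\<close> the twist lies in \<open>Ipow (l + 1)\<close> and
  \<open>d\<close> vanishes on \<open>carrier E\<close>, as order \<open>-1\<close> demands.\<close>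

lemma twisted_connection_Diff:
  assumes "j + m = Suc l" "s \<in> Ipow j" "\<And>u. u \<in> carrier E \<Longrightarrow> d u = twisted_connection l s u"
  shows "d \<in> Diff_shifted k A E (W l) m"
  using assms
proof (induction m arbitrary: j s d)
  case 0
  then have "s \<in> parts_ideal k A l"
    by (simp add: parts_ideal_def)
  then show ?case
    using 0 twisted_connection_Hom[OF ideal.Icarr[OF ideal_Ipow 0(2)]]
    by (simp add: twisted_connection_zero)
next
  case (Suc m)
  have s: "s \<in> carrier S"
    using ideal.Icarr[OF ideal_Ipow Suc.prems(2)] .
  have "commutator E (W l) d a \<in> Diff_shifted k A E (W l) m" if a: "a \<in> carrier A" for a
  proof (rule Suc.IH)
    show "Suc j + m = Suc l" using Suc.prems(1) by simp
    show "s \<otimes>\<^bsub>S\<^esub> delta a \<in> Ipow (Suc j)"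
      using Suc.prems(2) a by (rule Ipow_mult_delta)
  next
    fix u assume u: "u \<in> carrier E"
    have c: "twisted_connection l (s \<otimes>\<^bsub>S\<^esub> delta a) u \<in> carrier (W l)"
      "a \<odot>\<^bsub>W l\<^esub> twisted_connection l s u \<in> carrier (W l)"
      using s a u by (auto intro: pt.smult_tensor_closed)
    \<comment> \<open>The commutator subtracts exactly the second summand in
      \<open>twisted_connection_smult\<close>.\<close>
    show "commutator E (W l) d a u = twisted_connection l (s \<otimes>\<^bsub>S\<^esub> delta a) u"
      using s a u c
      by (simp add: commutator_def Suc.prems(3) twisted_connection_smult a_minus_def pt.T.a_assoc
          pt.T.r_neg)
  qed
  then show ?case
    using twisted_connection_Hom[OF s Suc.prems(3)] by simp
qed

lemma parts_connection_Diff: "parts_connection k A E n e x l \<in> Diff k A E (parts_tensor k A E l) l"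
proof -
  \<comment> \<open>\<open>Diff\<close> at \<open>l\<close> is \<open>Diff_shifted\<close> at
    \<open>Suc l\<close>, so the count starts at \<open>j = 0\<close> with
    \<open>m = Suc l\<close>.\<close>
  have "\<one>\<^bsub>S\<^esub> \<in> Ipow 0"
    by (subst Ipow_0) simp
  then show ?thesis
    unfolding Diff_def parts_tensor_def using twisted_connection_one
    by (intro twisted_connection_Diff[of 0]) auto
qed

section \<open>Compatibility with the projections\<close>

lemma balanced_parts_projection:
  assumes "l \<ge> 1"
  shows "pt.balanced_map l (add_monoid (W (l - 1)))
    (\<lambda>s u. pure_tensor A (P (l - 1)) E (parts_projection k A l s) u)"
  using parts_projection_linear[OF assms]
  by (simp add: pt.balanced_map_def pt.pure_add_l pt.pure_add_r pt.pure_balanced)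

text \<open>The lift of a sum is the sum of the lifts, and \<open>p_l\<close> sends the class of
  \<open>1 \<otimes> x_i(u)\<close> to the class of the same element one order lower.\<close>

lemma parts_projection_connection:
  assumes l: "l \<ge> 1" and u: "u \<in> carrier E"
  shows "parts_projection_tensor k A E l (parts_connection k A E n e x l u) =
    parts_connection k A E n e x (l - 1) u"
proof -
  note bal = balanced_parts_projection[OF l]
  have "parts_projection_tensor k A E l (parts_connection k A E n e x l u)
     = finsum (W (l - 1)) (\<lambda>i. parts_projection_tensor k A E l
         (pure_tensor A (P l) E (parts_universal k A l (x i u)) (e i))) {1..n}"
    unfolding parts_projection_tensor_def parts_connection_def parts_tensor_def
    using u by (intro pt.tensor_lift_finsum[OF pt.abelian_group_tensor bal]) (auto simp: parts_universal_def)
  \<comment> \<open>Without \<open>One_nat_def\<close> the index keeps the form \<open>l - 1\<close>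
    in which \<open>bal\<close> and \<open>parts_projection_class\<close> are stated.\<close>
  also have "\<dots> = parts_connection k A E n e x (l - 1) u"
    unfolding parts_connection_def parts_tensor_def
    using u by (intro pt.T.finsum_cong')
      (auto simp: parts_projection_tensor_def parts_tensor_def parts_universal_def
        parts_projection_class[OF l] pt.tensor_lift_pure[OF pt.T.a_comm_group bal]
        simp del: One_nat_def)
  finally show ?thesis .
qed

end

theorem theorem5p5:
  fixes k :: "'k ring" and A :: "('k, 'a) module" and E :: "('a, 'e) module"
    and n :: nat and e :: "nat \<Rightarrow> 'e" and x :: "nat \<Rightarrow> 'e \<Rightarrow> 'a" and l :: nat
  assumes "algebra k A" and "module A E" and "projective_basis A E n e x" and "l \<ge> 1"
  shows "parts_connection k A E n e x l \<in> Diff k A E (parts_tensor k A E l) l \<and>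
    (\<forall>u\<in>carrier E.
       parts_projection_tensor k A E l (parts_connection k A E n e x l u) =
       parts_connection k A E n e x (l - 1) u)"
proof -
  interpret projective_connection k A E n e x
    using assms by (simp add: projective_connection_def algebra_square_def projective_connection_axioms_def)
  show ?thesis
    using parts_connection_Diff parts_projection_connection[OF assms(4)] by blast
qed

end
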